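(* Let $G$ be a digraph. If $G$ has out-degeneracy $k$, then $$\zeta(G)\ge\log_{M(G)}(k+1),$$ where $$M(G)=\max_{u,v\in V(G)}\left(\max_{w\in N^+[v]}d(u,w)-\min_{w\in N^+[v]}d(u,w)\right)+1.$$
   Context: All digraphs are finite, nonempty, simple and oriented (no loops, at most one arc between any two distinct vertices). $N^+[v]$ is the closed out-neighborhood of $v$, i.e. $v$ together with its out-neighbors. The out-degeneracy of $G$ is the maximum, over all (nonempty) subgraphs $H$ of $G$, of the minimum out-degree $\delta^+(H)$. $d(u,v)$ is the length of a shortest directed path from $u$ to $v$, and $d(u,v)=\infty$ if there is no such path. Conventions for degenerate values: in the definition of $M(G)$, $\infty-\infty=0$ and $\infty-a=\infty$ for finite $a$; if $M(G)=\infty$ the right-hand side $\log_{M(G)}(k+1)$ is read as $0$; and $M(G)=1$ occurs only if $G$ has no arcs, in which case $k=0$ and $\log_1(1)$ is read as $0$. The Localization game with $k$ cops on $G$: an invisible robber first chooses a vertex; in each round the cops choose vertices $u_1,\dots,u_k$ (any vertices, chosen afresh each round) and learn the distance vector $(d(u_1,x),\ldots,d(u_k,x))$, where $x$ is the robber's current vertex; then the robber stays at $x$ or moves along an arc $(x,y)$ to an out-neighbor $y$. The cops win if they have a strategy which, whatever the robber does, after finitely many rounds determines a unique possible vertex for the robber right after a probe (using all information received so far); otherwise the robber wins. The localization number $\zeta(G)$ is the least positive integer $k$ for which $k$ cops have a winning strategy. *)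

theory Defs
  imports
    Complex_Main
    "Graph_Theory.Digraph_Component"
    "Graph_Theory.Shortest_Path"
begin

locale oriented_digraph = digraph +
  assumes verts_nonempty: "verts G \<noteq> {}"
    and oriented: "u \<rightarrow>\<^bsub>G\<^esub> v \<Longrightarrow> \<not> v \<rightarrow>\<^bsub>G\<^esub> u"

(* Infimum of walk lengths (unit arc weights); \<infinity> if there is no walk, as Inf {} = \<infinity> in ereal. *)
definition distance :: "('a,'b) pre_digraph \<Rightarrow> 'a \<Rightarrow> 'a \<Rightarrow> ereal" where
  "distance G u v = wf_digraph.\<mu> G (\<lambda>_. 1) u v"

definition closed_out_nbhd :: "('a,'b) pre_digraph \<Rightarrow> 'a \<Rightarrow> 'a set" where
  "closed_out_nbhd G v = insert v {w. v \<rightarrow>\<^bsub>G\<^esub> w}"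

definition min_out_degree :: "('a,'b) pre_digraph \<Rightarrow> nat" where
  "min_out_degree H = Min (out_degree H ` verts H)"

definition out_degeneracy :: "('a,'b) pre_digraph \<Rightarrow> nat" where
  "out_degeneracy G = Max {min_out_degree H | H. subgraph H G \<and> verts H \<noteq> {}}"

(* Library subtraction has \<infinity> - \<infinity> = \<infinity> on ereal. *)
definition dist_diff :: "ereal \<Rightarrow> ereal \<Rightarrow> ereal" where
  "dist_diff a b = (if a = \<infinity> \<and> b = \<infinity> then 0 else a - b)"

definition distance_spread :: "('a,'b) pre_digraph \<Rightarrow> ereal" where
  "distance_spread G =
     Max {dist_diff (Max (distance G u ` closed_out_nbhd G v))
                    (Min (distance G u ` closed_out_nbhd G v)) | u v.
          u \<in> verts G \<and> v \<in> verts G} + 1"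

(* Logarithm to a possibly infinite base; for base 1 the library gives log 1 1 = 0. *)
definition ext_log :: "ereal \<Rightarrow> real \<Rightarrow> real" where
  "ext_log b x = (if b = \<infinity> then 0 else log (real_of_ereal b) x)"


text \<open>
  The Localization game. A strategy maps the distance vectors received so far, one per completed
  round in chronological order, to the list of vertices probed next; the earlier probes need not
  be recorded, being determined by the strategy. A robber trajectory gives the robber's vertex
  at the time of each probe.
\<close>

definition cop_strategy ::
  "('a,'b) pre_digraph \<Rightarrow> nat \<Rightarrow> (ereal list list \<Rightarrow> 'a list) \<Rightarrow> bool" where
  "cop_strategy G k \<sigma> \<longleftrightarrow> (\<forall>h. length (\<sigma> h) = k \<and> set (\<sigma> h) \<subseteq> verts G)"

definition robber_trajectory :: "('a,'b) pre_digraph \<Rightarrow> (nat \<Rightarrow> 'a) \<Rightarrow> bool" where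
  "robber_trajectory G x \<longleftrightarrow> x 0 \<in> verts G \<and> (\<forall>n. x (Suc n) = x n \<or> x n \<rightarrow>\<^bsub>G\<^esub> x (Suc n))"

primrec answers ::
  "('a,'b) pre_digraph \<Rightarrow> (ereal list list \<Rightarrow> 'a list) \<Rightarrow> (nat \<Rightarrow> 'a) \<Rightarrow> nat \<Rightarrow> ereal list list" where
  "answers G \<sigma> x 0 = []"
| "answers G \<sigma> x (Suc n) =
     answers G \<sigma> x n @ [map (\<lambda>u. distance G u (x n)) (\<sigma> (answers G \<sigma> x n))]"

(* Right after probe number n (counting from 0), Suc n answers are known. *)
definition possible_vertices ::
  "('a,'b) pre_digraph \<Rightarrow> (ereal list list \<Rightarrow> 'a list) \<Rightarrow> (nat \<Rightarrow> 'a) \<Rightarrow> nat \<Rightarrow> 'a set" where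
  "possible_vertices G \<sigma> x n =
     {y n | y. robber_trajectory G y \<and> answers G \<sigma> y (Suc n) = answers G \<sigma> x (Suc n)}"

definition cops_win :: "('a,'b) pre_digraph \<Rightarrow> nat \<Rightarrow> bool" where
  "cops_win G k \<longleftrightarrow> (\<exists>\<sigma>. cop_strategy G k \<sigma> \<and>
     (\<forall>x. robber_trajectory G x \<longrightarrow> (\<exists>n. is_singleton (possible_vertices G \<sigma> x n))))"

definition localization_number :: "('a,'b) pre_digraph \<Rightarrow> nat" where
  "localization_number G = (LEAST k. k > 0 \<and> cops_win G k)"

end

theory Submission
  imports Defs
begin

text \<open>
  The robber survives by staying inside a subgraph \<open>H\<close> of minimum out-degree \<open>k\<close>. Suppose that at
  some moment, given what the cops know, the robber may be anywhere in the closed out-neighborhood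
  \<open>N\<close> of a vertex \<open>v\<close> inside \<open>H\<close>; this set has at least \<open>k + 1\<close> elements. By the definition of
  \<open>M = M(G)\<close>, the distances from one probed vertex to the elements of \<open>N\<close> take at most \<open>M\<close> values,
  so a probe of \<open>L\<close> vertices has at most \<open>M ^ L\<close> possible answers on \<open>N\<close>
  (\<open>card_distances_closed_out_nbhd\<close>, \<open>card_image_map_le\<close>). If \<open>M ^ L < k + 1\<close>, two different
  vertices of \<open>N\<close> receive the same answer. The robber moves to one of them, the cops cannot exclude
  the other, and the situation recurs around the robber's new vertex. This goes on forever
  (\<open>robber_evades\<close>), so a winning number \<open>L\<close> of cops has \<open>k + 1 \<le> M ^ L\<close>.

  The localization number is a least element, so the bound for winning numbers only applies to it
  because some number of cops wins at all: probing every vertex reveals the robber at once, being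
  at distance \<open>0\<close> from its own vertex only (\<open>cops_win_card_verts\<close>).
\<close>

lemma card_image_map_le:
  assumes "finite S" and "\<And>u. u \<in> set us \<Longrightarrow> card (f u ` S) \<le> m"
  shows "card ((\<lambda>w. map (\<lambda>u. f u w) us) ` S) \<le> m ^ length us"
  using assms(2)
proof (induction us)
  case Nil
  have "(\<lambda>w. map (\<lambda>u. f u w) []) ` S \<subseteq> {[]}" by auto
  from card_mono[OF _ this] show ?case by simp
next
  case (Cons a us)
  let ?R = "(\<lambda>w. map (\<lambda>u. f u w) us) ` S"
  have "(\<lambda>w. map (\<lambda>u. f u w) (a # us)) ` S \<subseteq> (\<lambda>(x, xs). x # xs) ` (f a ` S \<times> ?R)"
    by force
  then have "card ((\<lambda>w. map (\<lambda>u. f u w) (a # us)) ` S) \<le> card (f a ` S \<times> ?R)"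
    using \<open>finite S\<close> by (intro surj_card_le) auto
  also have "\<dots> = card (f a ` S) * card ?R"
    by (rule card_cartesian_product)
  also have "\<dots> \<le> m * m ^ length us"
    using Cons by (intro mult_mono) auto
  finally show ?case by simp
qed

text \<open>
  If the infinite distance occurs together with a finite one, the difference of the extremes is
  infinite; hence a finite difference means either one common infinite distance or integers in an
  interval.
\<close>

lemma card_le_of_dist_diff:
  assumes "finite A" "A \<noteq> {}" "A \<subseteq> range ereal_of_enat"
    and diff: "dist_diff (Max A) (Min A) \<le> ereal (real n)"
  shows "card A \<le> Suc n"
proof -
  have in_A: "Max A \<in> A" "Min A \<in> A" using assms by auto
  then obtain a b where ab: "Min A = ereal_of_enat a" "Max A = ereal_of_enat b"
    using assms(3) by blast
  show ?thesis
  proof (cases b)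
    case infinity
    then have "a = \<infinity>" using diff ab by (cases a) (auto simp: dist_diff_def)
    have "A \<subseteq> {\<infinity>}"
    proof
      fix x assume "x \<in> A"
      then have "Min A \<le> x" using assms by simp
      then show "x \<in> {\<infinity>}" using ab \<open>a = \<infinity>\<close> by simp
    qed
    from card_mono[OF _ this] show ?thesis by simp
  next
    case (enat j)
    have "Min A \<le> Max A" using assms by simp
    then have "a \<le> b" using ab by simp
    then obtain i where i: "a = enat i" using enat by (cases a) auto
    have "real j - real i \<le> real n"
      using diff ab i enat by (simp add: dist_diff_def)
    then have j: "j \<le> i + n" by linarith
    have "A \<subseteq> (\<lambda>t. ereal_of_enat (enat t)) ` {i..i + n}"
    proof
      fix x assume "x \<in> A"
      then have le: "Min A \<le> x" "x \<le> Max A" using assms by simp_all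
      obtain c where c: "x = ereal_of_enat c" using \<open>x \<in> A\<close> assms(3) by blast
      then have "a \<le> c" "c \<le> b" using le ab by simp_all
      then have "enat i \<le> c" "c \<le> enat j" using i enat by simp_all
      then show "x \<in> (\<lambda>t. ereal_of_enat (enat t)) ` {i..i + n}"
        using c j by (cases c) auto
    qed
    from surj_card_le[OF _ this] show ?thesis by simp
  qed
qed

section \<open>Distances\<close>

context wf_digraph
begin

text \<open>The infimum defining a distance is attained, since walk lengths are natural numbers.\<close>

lemma distance_infinite_or_attained:
  "distance G u v = \<infinity> \<or> (\<exists>p. awalk u p v \<and> distance G u v = ereal (real (length p)))"
proof (cases "\<exists>p. awalk u p v")
  case False
  then show ?thesis by (simp add: distance_def \<mu>_def top_ereal_def)
next
  case True
  then obtain p where p: "awalk u p v" "\<And>q. awalk u q v \<Longrightarrow> length p \<le> length q"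
    using ex_has_least_nat[of "\<lambda>p. awalk u p v" _ length] by blast
  have cost: "awalk_cost (\<lambda>_. 1) q = real (length q)" for q
    by (induction q) auto
  have "distance G u v = ereal (real (length p))"
    unfolding distance_def \<mu>_def cost
    using p by (intro antisym INF_lower2[of p] INF_greatest) auto
  with p show ?thesis by blast
qed

lemma distance_in_enat: "distance G u v \<in> range ereal_of_enat"
  using distance_infinite_or_attained[of u v]
  by (metis ereal_of_enat_simps(1,2) rangeI)

lemma distance_eq_0_iff:
  assumes "u \<in> verts G"
  shows "distance G u v = 0 \<longleftrightarrow> u = v"
proof
  assume "distance G u v = 0"
  then show "u = v"
    using distance_infinite_or_attained[of u v] by (auto simp: awalk_Nil_iff)
next
  assume "u = v"
  with assms have "awalk u [] v" by (simp add: awalk_Nil_iff)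
  from min_cost_le_walk_cost[OF this] have "distance G u v \<le> 0"
    by (simp add: distance_def zero_ereal_def)
  then show "distance G u v = 0"
    using distance_infinite_or_attained[of u v] by auto
qed

end

context fin_digraph
begin

lemma closed_out_nbhd_subset_verts: "v \<in> verts G \<Longrightarrow> closed_out_nbhd G v \<subseteq> verts G"
  by (auto simp: closed_out_nbhd_def arcs_ends_conv)

lemma finite_closed_out_nbhd: "finite (closed_out_nbhd G v)"
proof -
  have "closed_out_nbhd G v \<subseteq> insert v (verts G)"
    by (auto simp: closed_out_nbhd_def arcs_ends_conv)
  then show ?thesis using finite_subset by fastforce
qed

lemma card_distances_closed_out_nbhd:
  assumes "verts G \<noteq> {}" "distance_spread G \<noteq> \<infinity>"
  obtains m where "distance_spread G = ereal (real m)" "m \<ge> 1"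
    "\<And>u v. u \<in> verts G \<Longrightarrow> v \<in> verts G \<Longrightarrow> card (distance G u ` closed_out_nbhd G v) \<le> m"
proof -
  let ?A = "\<lambda>u v. distance G u ` closed_out_nbhd G v"
  let ?d = "\<lambda>u v. dist_diff (Max (?A u v)) (Min (?A u v))"
  let ?D = "{?d u v | u v. u \<in> verts G \<and> v \<in> verts G}"
  have A: "finite (?A u v)" "?A u v \<noteq> {}" "?A u v \<subseteq> range ereal_of_enat" for u v
    using finite_closed_out_nbhd distance_in_enat by (auto simp: closed_out_nbhd_def)
  have D_eq: "?D = (\<lambda>(u, v). ?d u v) ` (verts G \<times> verts G)" by auto
  have D: "finite ?D" "?D \<noteq> {}" using assms(1) unfolding D_eq by auto
  have spread: "distance_spread G = Max ?D + 1" by (simp add: distance_spread_def)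
  obtain u v where uv: "Max ?D = ?d u v" using Max_in[OF D] by blast
  have fin: "?d u v \<noteq> \<infinity>" using assms(2) spread uv by auto
  have "\<exists>n. ?d u v = ereal (real n)"
  proof -
    obtain a b where ab: "Min (?A u v) = ereal_of_enat a" "Max (?A u v) = ereal_of_enat b"
      using A[of u v] Max_in[of "?A u v"] Min_in[of "?A u v"] by blast
    have "Min (?A u v) \<le> Max (?A u v)"
      using A[of u v] by (intro Min_le Max_in)
    then have "a \<le> b" using ab by simp
    then show ?thesis
    proof (cases b)
      case infinity
      then have "?d u v = 0" using fin ab by (cases a) (auto simp: dist_diff_def)
      then show ?thesis by (intro exI[of _ 0]) simp
    next
      case (enat j)
      then obtain i where i: "a = enat i" "i \<le> j" using \<open>a \<le> b\<close> by (cases a) auto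
      then have "?d u v = ereal (real (j - i))"
        using ab enat by (simp add: dist_diff_def of_nat_diff)
      then show ?thesis by blast
    qed
  qed
  then obtain n where n: "Max ?D = ereal (real n)" using uv by metis
  show thesis
  proof
    show "distance_spread G = ereal (real (Suc n))"
      unfolding spread n by (simp add: one_ereal_def)
    show "card (?A u v) \<le> Suc n" if "u \<in> verts G" "v \<in> verts G" for u v
    proof (rule card_le_of_dist_diff[OF A])
      have "?d u v \<in> ?D" using that by blast
      from Max_ge[OF D(1) this] show "?d u v \<le> ereal (real n)" using n by simp
    qed
  qed simp
qed

section \<open>A subgraph witnessing the out-degeneracy\<close>

lemma out_degeneracy_attained:
  assumes "verts G \<noteq> {}"
  obtains H where "subgraph H G" "verts H \<noteq> {}"
    "\<And>v. v \<in> verts H \<Longrightarrow> out_degeneracy G \<le> out_degree H v"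
proof -
  let ?D = "{min_out_degree H | H. subgraph H G \<and> verts H \<noteq> {}}"
  have fin: "finite (verts H)" if "subgraph H G" for H
    using that finite_subset[OF _ finite_verts] by (auto simp: subgraph_def)
  have "?D \<subseteq> {..card (arcs G)}"
  proof
    fix d assume "d \<in> ?D"
    then obtain H where H: "subgraph H G" "verts H \<noteq> {}" and d: "d = min_out_degree H"
      by blast
    have "min_out_degree H \<in> out_degree H ` verts H"
      unfolding min_out_degree_def using fin[OF H(1)] H(2) by (intro Min_in) auto
    then obtain v where "min_out_degree H = out_degree H v" by blast
    moreover have "out_arcs H v \<subseteq> arcs G"
      using H(1) by (auto simp: subgraph_def)
    ultimately show "d \<in> {..card (arcs G)}"
      using card_mono[OF finite_arcs] d by (simp add: out_degree_def)
  qed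
  then have "finite ?D" using finite_subset by blast
  moreover have "?D \<noteq> {}" using assms subgraph_refl by blast
  ultimately have "out_degeneracy G \<in> ?D" unfolding out_degeneracy_def by (rule Max_in)
  then obtain H where H: "subgraph H G" "verts H \<noteq> {}" "out_degeneracy G = min_out_degree H"
    by blast
  show thesis
  proof (rule that[OF H(1,2)])
    show "out_degeneracy G \<le> out_degree H v" if "v \<in> verts H" for v
      unfolding H(3) min_out_degree_def using fin[OF H(1)] that by (intro Min_le) auto
  qed
qed

end

text \<open>
  Without loops and multiple arcs, out-neighbors are in bijection with outgoing arcs and differ
  from \<open>v\<close>.
\<close>

lemma (in digraph) card_closed_out_nbhd_subgraph:
  assumes "subgraph H G" "v \<in> verts H"
  shows "card (closed_out_nbhd H v) = Suc (out_degree H v)"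
    and "closed_out_nbhd H v \<subseteq> verts H \<inter> closed_out_nbhd G v"
proof -
  have H: "wf_digraph H" "arcs H \<subseteq> arcs G" "tail H = tail G" "head H = head G"
    using assms(1) by (auto simp: subgraph_def compatible_def)
  have eq: "closed_out_nbhd H v = insert v (head G ` out_arcs H v)"
    unfolding closed_out_nbhd_def arcs_ends_conv using H by auto
  have "v \<notin> head G ` out_arcs H v" using no_loops H by fastforce
  moreover have "inj_on (head G) (out_arcs H v)"
    using H by (auto simp: arc_to_ends_def intro!: inj_onI no_multi_arcs)
  moreover have "finite (out_arcs H v)"
    using H finite_subset[OF _ finite_arcs] by (metis out_arcs_in_arcs subsetI subset_trans)
  ultimately show "card (closed_out_nbhd H v) = Suc (out_degree H v)"
    unfolding eq by (simp add: card_image out_degree_def)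
  show "closed_out_nbhd H v \<subseteq> verts H \<inter> closed_out_nbhd G v"
    using assms(2) H wf_digraph.head_in_verts[OF H(1)]
    unfolding closed_out_nbhd_def arcs_ends_conv by auto
qed

section \<open>The game\<close>

lemma answers_cong:
  "(\<And>i. i < n \<Longrightarrow> x i = y i) \<Longrightarrow> answers G \<sigma> x n = answers G \<sigma> y n"
  by (induction n) auto

lemma robber_trajectory_iff:
  "robber_trajectory G x \<longleftrightarrow> x 0 \<in> verts G \<and> (\<forall>n. x (Suc n) \<in> closed_out_nbhd G (x n))"
  by (simp add: robber_trajectory_def closed_out_nbhd_def)

text \<open>
  Only \<open>w\<close> has to lie in \<open>W\<close>, because the robber goes there and the game continues around it. The
  vertex \<open>w'\<close> is a decoy that keeps the cops in doubt for one round: some trajectory consistent with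
  all answers ends there, and the next round supplies a new decoy.
\<close>

lemma (in fin_digraph) robber_evades:
  assumes W: "W \<subseteq> verts G" "W \<noteq> {}"
    and confuse: "\<And>v us. v \<in> W \<Longrightarrow> length us = L \<Longrightarrow> set us \<subseteq> verts G \<Longrightarrow>
      \<exists>w w'. w \<in> W \<and> w \<in> closed_out_nbhd G v \<and> w' \<in> closed_out_nbhd G v \<and> w \<noteq> w' \<and>
        map (\<lambda>u. distance G u w) us = map (\<lambda>u. distance G u w') us"
  shows "\<not> cops_win G L"
proof
  assume "cops_win G L"
  then obtain \<sigma> where \<sigma>: "cop_strategy G L \<sigma>"
    and win: "\<And>x. robber_trajectory G x \<Longrightarrow> \<exists>n. is_singleton (possible_vertices G \<sigma> x n)"
    unfolding cops_win_def by blast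
  let ?ans = "\<lambda>h w. map (\<lambda>u. distance G u w) (\<sigma> h)"
  let ?decoy = "\<lambda>v h w w'. w \<in> W \<and> w \<in> closed_out_nbhd G v \<and> w' \<in> closed_out_nbhd G v \<and>
    w \<noteq> w' \<and> ?ans h w = ?ans h w'"
  have ex: "\<exists>w w'. ?decoy v h w w'" if "v \<in> W" for v h
    using confuse[OF that] \<sigma> unfolding cop_strategy_def by blast
  define c where "c v h = (SOME w. \<exists>w'. ?decoy v h w w')" for v h
  define c' where "c' v h = (SOME w'. ?decoy v h (c v h) w')" for v h
  have c: "?decoy v h (c v h) (c' v h)" if "v \<in> W" for v h
  proof -
    have "\<exists>w'. ?decoy v h (c v h) w'"
      unfolding c_def by (rule someI_ex[OF ex[OF that]])
    then show ?thesis unfolding c'_def by (rule someI_ex)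
  qed
  obtain v0 where v0: "v0 \<in> W" using W by blast
  \<comment> \<open>A state is the vertex around which the robber's next vertex is chosen, together with the
    answers so far. The robber first chooses around \<open>v0\<close>, as if it had been there before the game.\<close>
  define step where "step = (\<lambda>(v, h). (c v h, h @ [?ans h (c v h)]))"
  define s where "s n = (step ^^ n) (v0, [])" for n
  define x where "x n = fst (s (Suc n))" for n
  have x_eq: "x n = c (fst (s n)) (snd (s n))" for n
    by (simp add: x_def s_def step_def split_beta)
  have s_Suc: "s (Suc n) = (x n, snd (s n) @ [?ans (snd (s n)) (x n)])" for n
    unfolding x_eq by (simp add: s_def step_def split_beta)
  have s_W: "fst (s n) \<in> W" for n
  proof (induction n)
    case 0
    show ?case by (simp add: s_def v0)
  next
    case (Suc n)
    then show ?case using c by (simp add: s_Suc x_eq)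
  qed
  have hist: "snd (s n) = answers G \<sigma> x n" for n
  proof (induction n)
    case 0
    show ?case by (simp add: s_def)
  next
    case (Suc n)
    then show ?case by (simp add: s_Suc)
  qed
  have x_W: "x n \<in> W" for n using s_W[of "Suc n"] by (simp add: x_def)
  have nbhd: "x (Suc n) \<in> closed_out_nbhd G (x n)" for n
    using c[OF s_W[of "Suc n"]] x_eq[of "Suc n"] by (simp add: x_def[of n])
  have traj: "robber_trajectory G x"
    using x_W W nbhd by (auto simp: robber_trajectory_iff)
  from win[OF this] obtain n where sing: "is_singleton (possible_vertices G \<sigma> x n)" by blast
  \<comment> \<open>A second robber that follows \<open>x\<close> but takes the decoy at time \<open>n\<close>, and stays there.\<close>
  define w' where "w' = c' (fst (s n)) (snd (s n))"
  have w': "w' \<in> closed_out_nbhd G (fst (s n))" "x n \<noteq> w'"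
    "?ans (answers G \<sigma> x n) (x n) = ?ans (answers G \<sigma> x n) w'"
    using c[OF s_W[of n], of "snd (s n)"] by (simp_all add: w'_def x_eq hist)
  define y where "y i = (if i < n then x i else w')" for i
  have "y 0 \<in> verts G"
  proof (cases n)
    case 0
    then show ?thesis
      using closed_out_nbhd_subset_verts w'(1) s_W W by (auto simp: y_def)
  next
    case (Suc m)
    then show ?thesis using x_W W by (auto simp: y_def)
  qed
  moreover have "y (Suc i) \<in> closed_out_nbhd G (y i)" for i
  proof -
    consider "Suc i < n" | "n = Suc i" | "n \<le> i" by linarith
    then show ?thesis
    proof cases
      case 1
      then show ?thesis using nbhd by (simp add: y_def)
    next
      case 2
      then show ?thesis using w'(1) by (simp add: y_def x_def)
    next
      case 3
      then show ?thesis by (simp add: y_def closed_out_nbhd_def)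
    qed
  qed
  ultimately have "robber_trajectory G y" by (simp add: robber_trajectory_iff)
  moreover have "answers G \<sigma> y n = answers G \<sigma> x n"
    by (rule answers_cong) (simp add: y_def)
  then have "answers G \<sigma> y (Suc n) = answers G \<sigma> x (Suc n)"
    using w'(3) by (simp add: y_def)
  ultimately have "y n \<in> possible_vertices G \<sigma> x n"
    unfolding possible_vertices_def by blast
  then have "w' \<in> possible_vertices G \<sigma> x n" by (simp add: y_def)
  moreover have "x n \<in> possible_vertices G \<sigma> x n"
    unfolding possible_vertices_def using traj by blast
  ultimately show False using sing w'(2) by (auto simp: is_singleton_def)
qed

lemma (in fin_digraph) cops_win_card_verts: "cops_win G (card (verts G))"
proof -
  obtain vs where vs: "set vs = verts G" "length vs = card (verts G)"
    using finite_distinct_list[OF finite_verts] distinct_card by metis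
  let ?\<sigma> = "\<lambda>_ :: ereal list list. vs"
  have "possible_vertices G ?\<sigma> x 0 = {x 0}" if x: "robber_trajectory G x" for x
  proof -
    have x0: "x 0 \<in> verts G" using x by (simp add: robber_trajectory_def)
    have "y 0 = x 0" if "answers G ?\<sigma> y (Suc 0) = answers G ?\<sigma> x (Suc 0)" for y
    proof -
      have "distance G (x 0) (y 0) = distance G (x 0) (x 0)" using that x0 vs by simp
      then show ?thesis using distance_eq_0_iff[OF x0] by metis
    qed
    then show ?thesis unfolding possible_vertices_def using x by blast
  qed
  moreover have "cop_strategy G (card (verts G)) ?\<sigma>"
    using vs by (simp add: cop_strategy_def)
  ultimately show ?thesis
    unfolding cops_win_def by (metis is_singletonI)
qed

text \<open>
  In the subgraph that attains the out-degeneracy, a closed out-neighborhood has more elements than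
  there are answers to a probe of \<open>L\<close> vertices as soon as \<open>m ^ L\<close> is at most the out-degeneracy;
  by the pigeonhole principle two of its elements then get the same answer.
\<close>

lemma (in digraph) Suc_out_degeneracy_le_power:
  assumes "verts G \<noteq> {}" and win: "cops_win G L"
    and m: "\<And>u v. u \<in> verts G \<Longrightarrow> v \<in> verts G \<Longrightarrow> card (distance G u ` closed_out_nbhd G v) \<le> m"
  shows "Suc (out_degeneracy G) \<le> m ^ L"
proof (rule ccontr)
  assume less: "\<not> Suc (out_degeneracy G) \<le> m ^ L"
  obtain H where H: "subgraph H G" "verts H \<noteq> {}"
    "\<And>v. v \<in> verts H \<Longrightarrow> out_degeneracy G \<le> out_degree H v"
    using out_degeneracy_attained[OF assms(1)] by blast
  have HG: "verts H \<subseteq> verts G" using H(1) by (auto simp: subgraph_def)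
  have "\<not> cops_win G L"
  proof (rule robber_evades[OF HG H(2)])
    fix v us assume v: "v \<in> verts H" and us: "length us = L" "set us \<subseteq> verts G"
    let ?N = "closed_out_nbhd H v"
    let ?ans = "\<lambda>w. map (\<lambda>u. distance G u w) us"
    note N = card_closed_out_nbhd_subgraph[OF H(1) v]
    have fin: "finite ?N" using N(2) finite_closed_out_nbhd finite_subset by blast
    have "card (?ans ` ?N) \<le> m ^ length us"
    proof (rule card_image_map_le[OF fin])
      fix u assume "u \<in> set us"
      have "card (distance G u ` ?N) \<le> card (distance G u ` closed_out_nbhd G v)"
        using N(2) finite_closed_out_nbhd by (intro card_mono image_mono) auto
      also have "\<dots> \<le> m" using m \<open>u \<in> set us\<close> us v HG by blast
      finally show "card (distance G u ` ?N) \<le> m" .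
    qed
    also have "\<dots> < card ?N" using less us N(1) H(3)[OF v] by simp
    finally have "\<not> inj_on ?ans ?N" by (rule pigeonhole)
    then show "\<exists>w w'. w \<in> verts H \<and> w \<in> closed_out_nbhd G v \<and> w' \<in> closed_out_nbhd G v \<and>
        w \<noteq> w' \<and> ?ans w = ?ans w'"
      using N(2) unfolding inj_on_def by blast
  qed
  with win show False by blast
qed

theorem theorem11:
  fixes G :: "('a,'b) pre_digraph" and k :: nat
  assumes "oriented_digraph G"
    and "out_degeneracy G = k"
  shows "real (localization_number G) \<ge> ext_log (distance_spread G) (real k + 1)"
proof -
  interpret oriented_digraph G by (rule assms(1))
  let ?L = "localization_number G"
  have "card (verts G) > 0 \<and> cops_win G (card (verts G))"
    using cops_win_card_verts verts_nonempty by (simp add: card_gt_0_iff)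
  then have win: "cops_win G ?L"
    unfolding localization_number_def by (rule LeastI2) simp
  show ?thesis
  proof (cases "distance_spread G = \<infinity>")
    case True
    then show ?thesis by (simp add: ext_log_def)
  next
    case False
    obtain m where m: "distance_spread G = ereal (real m)" "m \<ge> 1"
      "\<And>u v. u \<in> verts G \<Longrightarrow> v \<in> verts G \<Longrightarrow> card (distance G u ` closed_out_nbhd G v) \<le> m"
      using card_distances_closed_out_nbhd[OF verts_nonempty False] by blast
    have le: "Suc k \<le> m ^ ?L"
      using Suc_out_degeneracy_le_power[OF verts_nonempty win m(3)] assms(2) by simp
    have "log (real m) (real k + 1) \<le> real ?L"
    proof (cases "m = 1")
      case True
      \<comment> \<open>The quotient \<open>ln (k + 1) / ln 1\<close> is a division by zero, with value \<open>0\<close>.\<close>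
      then show ?thesis by (simp add: log_def)
    next
      case False
      then have "m > 1" using m(2) by simp
      have "real (Suc k) \<le> real (m ^ ?L)" using le by (simp only: of_nat_le_iff)
      then have "real k + 1 \<le> real m powr real ?L"
        using \<open>m > 1\<close> by (simp add: powr_realpow add.commute)
      then show ?thesis using \<open>m > 1\<close> by (simp add: log_le_iff)
    qed
    then show ?thesis using m(1) by (simp add: ext_log_def)
  qed
qed

end
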